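(* Let $A$ and $E$ be real symmetric $n\times n$ matrices and $\tilde A=A+E$. Let $\lambda_1\ge\lambda_2\ge\dots\ge\lambda_n$ be the eigenvalues of $A$ with corresponding orthonormal eigenvectors $u_1,\dots,u_n$, and let $\sigma_1=\max_i|\lambda_i|=\|A\|$. Let $1\le p<n$ and put $\delta_p:=\lambda_p-\lambda_{p+1}>0$. Let $r\ge p$ be the smallest integer such that $\frac{|\lambda_p|}{2}\le|\lambda_p-\lambda_{r+1}|$ (with $r+1\le n$), and set $x:=\max_{1\le i,j\le r}|u_i^\top E u_j|$. Assume that $$4\|E\|\le\delta_p\le\frac{|\lambda_p|}{4}.$$ Then $$\|\tilde\Pi_p-\Pi_p\|\le 24\left(\frac{\|E\|}{|\lambda_p|}\log\left(\frac{6\sigma_1}{\delta_p}\right)+\frac{r^2x}{\delta_p}\right).$$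
   Context: $\|\cdot\|$ is the spectral norm and $\log$ is the natural logarithm. $\Pi_p:=\sum_{i=1}^p u_iu_i^\top$ is the orthogonal projection onto the span of the eigenvectors of $A$ for its $p$ largest eigenvalues. Likewise $\tilde\Pi_p:=\sum_{i=1}^p\tilde u_i\tilde u_i^\top$, where $\tilde\lambda_1\ge\dots\ge\tilde\lambda_n$ are the eigenvalues of $\tilde A$ with orthonormal eigenvectors $\tilde u_1,\dots,\tilde u_n$. *)

theory Defs
  imports "HOL-Analysis.Analysis"
begin

definition spectral_norm :: "real^'n^'n \<Rightarrow> real" where
  "spectral_norm M = onorm (\<lambda>v. M *v v)"

definition outer :: "real^'n \<Rightarrow> real^'n \<Rightarrow> real^'n^'n" where
  "outer v w = (\<chi> i j. v $ i * w $ j)"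

text \<open>The sequences are indexed by \<open>{1..CARD('n)}\<close>; values outside that range are unconstrained.
  As the \<open>u i\<close> form an orthonormal basis of the whole space, the \<open>lam i\<close> are all the eigenvalues
  of \<open>A\<close>, counted with multiplicity.\<close>

definition ordered_eigensystem ::
    "real^'n^'n \<Rightarrow> (nat \<Rightarrow> real) \<Rightarrow> (nat \<Rightarrow> real^'n) \<Rightarrow> bool" where
  "ordered_eigensystem A lam u \<longleftrightarrow>
     (\<forall>i\<in>{1..CARD('n)}. A *v u i = lam i *\<^sub>R u i) \<and>
     (\<forall>i\<in>{1..CARD('n)}. \<forall>j\<in>{1..CARD('n)}. u i \<bullet> u j = (if i = j then 1 else 0)) \<and>
     (\<forall>i\<in>{1..CARD('n)}. \<forall>j\<in>{1..CARD('n)}. i \<le> j \<longrightarrow> lam j \<le> lam i)"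

definition eigenprojection :: "(nat \<Rightarrow> real^'n) \<Rightarrow> nat \<Rightarrow> real^'n^'n" where
  "eigenprojection u p = (\<Sum>i=1..p. outer (u i) (u i))"

end

theory Submission
  imports Defs
begin

text \<open>
  Split the complement of the span of \<open>u 1, \<dots>, u p\<close> into the
  far block \<open>i > r\<close>, whose eigenvalues lie at least \<open>\<bar>lam p\<bar> / 2\<close> below \<open>lam p\<close>, and the near block
  \<open>p < i \<le> r\<close>, separated from \<open>lam p\<close> by \<open>\<delta>\<close> only. The one-sided sin-theta theorem, with Weyl's
  inequality for the perturbed eigenvalues, bounds the far component of a perturbed eigenspace
  vector by a multiple of \<open>\<parallel>E\<parallel> / \<bar>lam p\<bar>\<close>. On the near block it is applied to \<open>E\<close> restricted to the
  perturbed eigenspace: there the components along \<open>u 1, \<dots>, u r\<close> see \<open>E\<close> only through the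
  entries bounded by \<open>x\<close>, and the far components have just been shown to be small. Since the two
  eigenspaces have equal dimension, this one-sided bound controls the difference of the projections.
\<close>

section \<open>Orthonormal families and the projections onto their spans\<close>

definition orthonormal_on :: "nat set \<Rightarrow> (nat \<Rightarrow> 'a::euclidean_space) \<Rightarrow> bool" where
  "orthonormal_on I u \<longleftrightarrow> (\<forall>i\<in>I. \<forall>j\<in>I. u i \<bullet> u j = (if i = j then 1 else 0))"

text \<open>Vector-level form of \<open>eigenprojection\<close> for an arbitrary index set, so that
  the blocks of eigenvectors can be treated separately; \<open>orthonormal_on I u\<close> makes it
  an orthogonal projection.\<close>

definition proj_on :: "(nat \<Rightarrow> 'a::euclidean_space) \<Rightarrow> nat set \<Rightarrow> 'a \<Rightarrow> 'a" where
  "proj_on u I v = (\<Sum>i\<in>I. (u i \<bullet> v) *\<^sub>R u i)"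

lemma orthonormal_on_subset: "orthonormal_on N u \<Longrightarrow> I \<subseteq> N \<Longrightarrow> orthonormal_on I u"
  unfolding orthonormal_on_def by blast

lemma linear_proj_on: "linear (proj_on u I)"
  unfolding proj_on_def
  by (rule linearI)
    (simp_all add: inner_add_right scaleR_add_left sum.distrib scaleR_sum_right)

lemma inner_orthonormal_sum:
  assumes "orthonormal_on I u" "finite I" "i \<in> I"
  shows "u i \<bullet> (\<Sum>j\<in>I. c j *\<^sub>R u j) = c i"
proof -
  have "u i \<bullet> (\<Sum>j\<in>I. c j *\<^sub>R u j) = (\<Sum>j\<in>I. if i = j then c j else 0)"
    using assms unfolding inner_sum_right orthonormal_on_def by (intro sum.cong) auto
  then show ?thesis using assms by simp
qed

lemma norm_orthonormal_sum:
  assumes "orthonormal_on I u" "finite I"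
  shows "(norm (\<Sum>j\<in>I. c j *\<^sub>R u j))\<^sup>2 = (\<Sum>j\<in>I. (c j)\<^sup>2)"
proof -
  have "(norm (\<Sum>j\<in>I. c j *\<^sub>R u j))\<^sup>2 = (\<Sum>i\<in>I. c i * (u i \<bullet> (\<Sum>j\<in>I. c j *\<^sub>R u j)))"
    unfolding power2_norm_eq_inner inner_sum_left by simp
  also have "\<dots> = (\<Sum>j\<in>I. (c j)\<^sup>2)"
    using inner_orthonormal_sum[OF assms] by (intro sum.cong) (auto simp: power2_eq_square)
  finally show ?thesis .
qed

text \<open>Turns bounds on spectral multipliers into norm bounds: an operator that is diagonal in
  \<open>u\<close> with multipliers at most \<open>k\<close> in absolute value expands norms by at
  most \<open>k\<close>.\<close>

lemma norm_orthonormal_sum_mono: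
  assumes "orthonormal_on I u" "finite I" "\<And>i. i \<in> I \<Longrightarrow> \<bar>c i\<bar> \<le> k * \<bar>d i\<bar>" "0 \<le> k"
  shows "norm (\<Sum>i\<in>I. c i *\<^sub>R u i) \<le> k * norm (\<Sum>i\<in>I. d i *\<^sub>R u i)"
proof (rule power2_le_imp_le)
  have "(c i)\<^sup>2 \<le> k\<^sup>2 * (d i)\<^sup>2" if "i \<in> I" for i
    using power_mono[OF assms(3)[OF that], of 2] by (simp add: power_mult_distrib)
  then have "(\<Sum>i\<in>I. (c i)\<^sup>2) \<le> k\<^sup>2 * (\<Sum>i\<in>I. (d i)\<^sup>2)"
    unfolding sum_distrib_left by (rule sum_mono)
  then show "(norm (\<Sum>i\<in>I. c i *\<^sub>R u i))\<^sup>2 \<le> (k * norm (\<Sum>i\<in>I. d i *\<^sub>R u i))\<^sup>2"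
    using norm_orthonormal_sum[OF assms(1,2)] by (simp add: power_mult_distrib)
qed (use assms in simp)

lemma proj_on_sum:
  assumes "orthonormal_on I u" "finite I"
  shows "proj_on u I (\<Sum>j\<in>I. c j *\<^sub>R u j) = (\<Sum>j\<in>I. c j *\<^sub>R u j)"
  unfolding proj_on_def using inner_orthonormal_sum[OF assms] by (intro sum.cong) auto

lemma proj_on_idem:
  assumes "orthonormal_on I u" "finite I"
  shows "proj_on u I (proj_on u I v) = proj_on u I v"
  unfolding proj_on_def[of u I v] by (rule proj_on_sum[OF assms])

lemma inner_proj_on_commute: "proj_on u I v \<bullet> w = v \<bullet> proj_on u I w"
  unfolding proj_on_def inner_sum_left inner_sum_right by (simp add: inner_commute mult.commute)

lemma norm_proj_on:
  assumes "orthonormal_on I u" "finite I"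
  shows "(norm (proj_on u I v))\<^sup>2 = proj_on u I v \<bullet> v"
  unfolding power2_norm_eq_inner
  by (metis proj_on_idem[OF assms] inner_proj_on_commute)

lemma norm_sub_proj_on:
  assumes "orthonormal_on I u" "finite I"
  shows "(norm (v - proj_on u I v))\<^sup>2 = (norm v)\<^sup>2 - (norm (proj_on u I v))\<^sup>2"
  using norm_proj_on[OF assms, of v]
  by (simp add: power2_norm_eq_inner inner_diff_left inner_diff_right inner_commute)

lemma norm_proj_on_le:
  assumes "orthonormal_on I u" "finite I"
  shows "norm (proj_on u I v) \<le> norm v" "norm (v - proj_on u I v) \<le> norm v"
proof -
  have "(norm (proj_on u I v))\<^sup>2 \<le> (norm v)\<^sup>2" "(norm (v - proj_on u I v))\<^sup>2 \<le> (norm v)\<^sup>2"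
    using norm_sub_proj_on[OF assms, of v]
      zero_le_power2[of "norm (proj_on u I v)"] zero_le_power2[of "norm (v - proj_on u I v)"]
    by linarith+
  then show "norm (proj_on u I v) \<le> norm v" "norm (v - proj_on u I v) \<le> norm v"
    by (auto intro: power2_le_imp_le)
qed

lemma orthonormal_on_independent:
  assumes "orthonormal_on I u" "finite I"
  shows "inj_on u I" "independent (u ` I)" "dim (span (u ` I)) = card I"
proof -
  show inj: "inj_on u I"
    using assms(1) unfolding orthonormal_on_def inj_on_def by (metis zero_neq_one)
  have "pairwise orthogonal (u ` I)" "0 \<notin> u ` I"
    using assms(1) unfolding orthonormal_on_def pairwise_def orthogonal_def
    by (auto, metis inner_zero_left zero_neq_one)
  then show ind: "independent (u ` I)"
    by (rule pairwise_orthogonal_independent)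
  show "dim (span (u ` I)) = card I"
    using dim_eq_card_independent[OF ind] card_image[OF inj] by simp
qed

lemma proj_on_in_span: "proj_on u I v \<in> span (u ` I)"
  unfolding proj_on_def by (intro span_sum span_scale span_base) auto

lemma range_proj_on:
  assumes "orthonormal_on I u" "finite I"
  shows "range (proj_on u I) = span (u ` I)"
proof
  show "range (proj_on u I) \<subseteq> span (u ` I)"
    using proj_on_in_span by blast
  have "u i = proj_on u I (u i)" if "i \<in> I" for i
  proof -
    have "proj_on u I (u i) = (\<Sum>j\<in>I. if i = j then u j else 0)"
      using assms that unfolding proj_on_def orthonormal_on_def by (intro sum.cong) auto
    then show ?thesis using that assms by simp
  qed
  then have "u ` I \<subseteq> range (proj_on u I)" by blast
  moreover have "subspace (range (proj_on u I))"
    by (intro linear_subspace_image linear_proj_on) simp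
  ultimately show "span (u ` I) \<subseteq> range (proj_on u I)"
    by (rule span_minimal)
qed

text \<open>A full orthonormal family spans the space by counting dimensions, and a projection fixes
  its range.\<close>

lemma proj_on_basis:
  fixes u :: "nat \<Rightarrow> 'a::euclidean_space"
  assumes "orthonormal_on I u" "finite I" "card I = DIM('a)"
  shows "proj_on u I v = v"
proof -
  have "span (u ` I) = UNIV"
    using orthonormal_on_independent(3)[OF assms(1,2)] assms(3) dim_eq_full[of "u ` I"] by simp
  then obtain w where "v = proj_on u I w"
    using range_proj_on[OF assms(1,2)] by (metis UNIV_I imageE)
  then show ?thesis using proj_on_idem[OF assms(1,2)] by simp
qed

lemma proj_on_Un:
  assumes "finite I" "finite J" "I \<inter> J = {}"
  shows "proj_on u (I \<union> J) v = proj_on u I v + proj_on u J v"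
  unfolding proj_on_def using assms by (rule sum.union_disjoint)

lemma proj_on_decomp:
  fixes u :: "nat \<Rightarrow> 'a::euclidean_space"
  assumes "orthonormal_on (I \<union> J) u" "finite (I \<union> J)" "I \<inter> J = {}" "card (I \<union> J) = DIM('a)"
  shows "v = proj_on u I v + proj_on u J v"
  using proj_on_basis[OF assms(1,2,4), of v] proj_on_Un[of I J u v] assms(2,3) by simp

section \<open>One-sided sin-theta theorem\<close>

text \<open>The contraction argument: with \<open>c\<close> a lower bound of the \<open>lam i\<close>, dividing by \<open>A' - c\<close> on the
  second eigenspace and multiplying by \<open>A - c\<close> on the first shrinks norms by
  \<open>(\<alpha> - c) / (\<beta> - c) < 1\<close>.\<close>

lemma sin_theta:
  fixes A A' :: "'a::euclidean_space \<Rightarrow> 'a"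
  assumes linA': "linear A'"
    and sym: "\<And>v w. A v \<bullet> w = v \<bullet> A w"
    and u: "orthonormal_on I u" "finite I" "\<And>i. i \<in> I \<Longrightarrow> A (u i) = lam i *\<^sub>R u i"
    and u': "orthonormal_on J u'" "finite J" "\<And>j. j \<in> J \<Longrightarrow> A' (u' j) = lam' j *\<^sub>R u' j"
    and lam: "\<And>i. i \<in> I \<Longrightarrow> lam i \<le> \<alpha>" and lam': "\<And>j. j \<in> J \<Longrightarrow> \<beta> \<le> lam' j"
    and gap: "\<alpha> < \<beta>"
    and Y: "\<And>w. norm (proj_on u I (A' (proj_on u' J w) - A (proj_on u' J w))) \<le> Y * norm w"
  shows "norm (proj_on u I (proj_on u' J v)) \<le> Y / (\<beta> - \<alpha>) * norm v"
proof -
  define X where "X v = proj_on u I (proj_on u' J v)" for v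
  have "linear X"
    unfolding X_def using linear_compose[OF linear_proj_on linear_proj_on] by (simp add: o_def)
  then have bl: "bounded_linear X" by (simp add: linear_conv_bounded_linear)
  \<comment> \<open>The bound is self-improving: \<open>step\<close> estimates \<open>X\<close> in
    terms of its own norm \<open>K\<close>, and the resulting inequality is then solved for
    \<open>K\<close>.\<close>
  define K where "K = onorm X"
  have K: "norm (X v) \<le> K * norm v" for v
    unfolding K_def by (rule onorm[OF bl])
  \<comment> \<open>Inserting \<alpha> keeps the minimum meaningful for empty \<open>I\<close> and
    ensures \<open>c \<le> \<alpha>\<close>.\<close>
  define c where "c = Min (insert \<alpha> (lam ` I))"
  have c: "c \<le> \<alpha>" "\<And>i. i \<in> I \<Longrightarrow> c \<le> lam i"
    unfolding c_def using u(2) by auto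
  have step: "norm (X v) \<le> ((\<alpha> - c) * K + Y) / (\<beta> - c) * norm v" for v
  proof -
    \<comment> \<open>The preimage of \<open>proj_on u' J v\<close> under \<open>A' - c\<close>
      inside the second eigenspace; there \<open>A' - c\<close> has eigenvalues at least
      \<open>\<beta> - c > 0\<close>.\<close>
    define w where "w = (\<Sum>j\<in>J. ((u' j \<bullet> v) / (lam' j - c)) *\<^sub>R u' j)"
    have pos: "0 < \<beta> - c" "\<And>j. j \<in> J \<Longrightarrow> \<beta> - c \<le> lam' j - c"
      using c gap lam' by auto
    have w: "proj_on u' J w = w"
      unfolding w_def by (rule proj_on_sum[OF u'(1,2)])
    have "norm w \<le> 1 / (\<beta> - c) * norm (proj_on u' J v)"
      unfolding w_def proj_on_def
    proof (rule norm_orthonormal_sum_mono[OF u'(1,2)])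
      fix j assume "j \<in> J"
      then show "\<bar>(u' j \<bullet> v) / (lam' j - c)\<bar> \<le> 1 / (\<beta> - c) * \<bar>u' j \<bullet> v\<bar>"
        using pos(1) pos(2)[of j] by (simp add: abs_divide frac_le)
    qed (use pos in simp)
    also have "\<dots> \<le> 1 / (\<beta> - c) * norm v"
      using norm_proj_on_le(1)[OF u'(1,2)] pos by (intro mult_left_mono) auto
    finally have nw: "norm w \<le> 1 / (\<beta> - c) * norm v" .
    have "A' w - c *\<^sub>R w = (\<Sum>j\<in>J. ((u' j \<bullet> v) / (lam' j - c)) *\<^sub>R (A' (u' j) - c *\<^sub>R u' j))"
      unfolding w_def linear_sum[OF linA'] linear_cmul[OF linA'] scaleR_sum_right
      by (simp add: scaleR_diff_right sum_subtractf mult.commute)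
    also have "\<dots> = proj_on u' J v"
      unfolding proj_on_def
    proof (rule sum.cong[OF refl])
      fix j assume j: "j \<in> J"
      have "lam' j - c \<noteq> 0" using pos(1) pos(2)[OF j] by linarith
      moreover have "A' (u' j) - c *\<^sub>R u' j = (lam' j - c) *\<^sub>R u' j"
        using u'(3)[OF j] by (simp add: scaleR_diff_left)
      ultimately show "((u' j \<bullet> v) / (lam' j - c)) *\<^sub>R (A' (u' j) - c *\<^sub>R u' j) = (u' j \<bullet> v) *\<^sub>R u' j"
        by simp
    qed
    finally have eq: "proj_on u' J v = A' w - c *\<^sub>R w" ..
    \<comment> \<open>Replacing \<open>A'\<close> by \<open>A\<close> in
      \<open>A' w - c *\<^sub>R w\<close> costs \<open>Y * norm w\<close>; the rest,
      \<open>y\<close>, equals \<open>A - c\<close> applied to \<open>X w\<close>, as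
      \<open>A\<close> is symmetric and diagonal on the \<open>u i\<close>.\<close>
    define y where "y = proj_on u I (A w - c *\<^sub>R w)"
    have "X v = y + proj_on u I (A' w - A w)"
      unfolding X_def eq y_def linear_add[OF linear_proj_on, symmetric] by simp
    then have "norm (X v) \<le> norm y + norm (proj_on u I (A' w - A w))"
      using norm_triangle_ineq by metis
    also have "norm y \<le> (\<alpha> - c) * norm (X w)"
    proof -
      have "y = (\<Sum>i\<in>I. ((lam i - c) * (u i \<bullet> w)) *\<^sub>R u i)"
        unfolding y_def proj_on_def
      proof (rule sum.cong[OF refl])
        fix i assume i: "i \<in> I"
        have "u i \<bullet> A w = lam i * (u i \<bullet> w)"
          using sym[of "u i" w] u(3)[OF i] by simp
        then show "(u i \<bullet> (A w - c *\<^sub>R w)) *\<^sub>R u i = ((lam i - c) * (u i \<bullet> w)) *\<^sub>R u i"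
          by (simp add: inner_diff_right algebra_simps)
      qed
      moreover have "X w = (\<Sum>i\<in>I. (u i \<bullet> w) *\<^sub>R u i)"
        unfolding X_def w by (simp add: proj_on_def)
      ultimately show ?thesis
        using c lam by (auto intro!: norm_orthonormal_sum_mono[OF u(1,2)] mult_right_mono simp: abs_mult)
    qed
    also have "(\<alpha> - c) * norm (X w) \<le> (\<alpha> - c) * (K * norm w)"
      using K c by (intro mult_left_mono) auto
    also have "norm (proj_on u I (A' w - A w)) \<le> Y * norm w"
      using Y[of w] w by simp
    finally have *: "norm (X v) \<le> ((\<alpha> - c) * K + Y) * norm w"
      by (simp add: algebra_simps)
    \<comment> \<open>The bound on \<open>norm w\<close> can be inserted only if its factor is
      nonnegative. A negative factor forces \<open>w = 0\<close> by \<open>*\<close>, hence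
      \<open>X v = 0\<close>.\<close>
    show ?thesis
    proof (cases "0 \<le> (\<alpha> - c) * K + Y")
      case True
      show ?thesis
        using order_trans[OF * mult_left_mono[OF nw True]] by simp
    next
      case False
      then have "norm w \<le> 0"
        using * norm_ge_zero[of "X v"] by (smt (verit) mult_neg_pos)
      then have "norm (proj_on u' J v) = 0"
        unfolding eq using linear_0[OF linA'] by simp
      then have "X v = 0"
        unfolding X_def using linear_0[OF linear_proj_on] by simp
      have "0 \<le> Y * norm v" using Y[of v] norm_ge_zero order_trans by blast
      moreover have "0 \<le> K" unfolding K_def using onorm_pos_le[OF bl] .
      ultimately have "0 \<le> ((\<alpha> - c) * K + Y) * norm v"
        using c by (simp add: distrib_right)
      then show ?thesis
        using \<open>X v = 0\<close> pos by simp
    qed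
  qed
  have "K \<le> ((\<alpha> - c) * K + Y) / (\<beta> - c)"
    unfolding K_def
    by (rule onorm_le) (use step in \<open>simp add: K_def\<close>)
  \<comment> \<open>Clearing the denominator leaves \<open>(\<beta> - \<alpha>) * K \<le> Y\<close>:
    the shift \<open>c\<close> cancels.\<close>
  then have "K \<le> Y / (\<beta> - \<alpha>)"
    using c gap by (simp add: field_simps)
  then have "K * norm v \<le> Y / (\<beta> - \<alpha>) * norm v"
    by (rule mult_right_mono) simp
  then show ?thesis
    using K[of v] unfolding X_def by linarith
qed

section \<open>Differences of projections of equal rank\<close>

lemma dim_image_injective:
  fixes f :: "'a::euclidean_space \<Rightarrow> 'b::euclidean_space"
  assumes "linear f" "subspace S" "\<And>x. x \<in> S \<Longrightarrow> f x = 0 \<Longrightarrow> x = 0"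
  shows "dim (f ` S) = dim S"
proof -
  have "inj_on f S"
  proof (rule inj_onI)
    fix x y assume "x \<in> S" "y \<in> S" "f x = f y"
    then show "x = y"
      using assms(3)[of "x - y"] linear_diff[OF assms(1)] subspace_diff[OF assms(2)] by simp
  qed
  then show ?thesis
    using dim_image_eq[OF assms(1)] assms(2) by (metis span_eq_iff)
qed

text \<open>With \<open>P\<close> and \<open>P'\<close> the two projections,
  \<open>P' - P = (1 - P) P' - P (1 - P')\<close>. The first term is bounded by hypothesis; equal
  ranks give the same bound for the second, whence the factor 2. For \<open>s \<ge> 1\<close> the
  claim is trivial.\<close>

lemma norm_diff_proj_on_le:
  fixes u u' :: "nat \<Rightarrow> 'a::euclidean_space"
  assumes u: "orthonormal_on I u" and u': "orthonormal_on I u'" and fin: "finite I"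
    and "0 \<le> s"
    and s: "\<And>v. norm (proj_on u' I v - proj_on u I (proj_on u' I v)) \<le> s * norm v"
  shows "norm (proj_on u' I v - proj_on u I v) \<le> 2 * s * norm v"
proof (cases "s < 1")
  case False
  have "norm (proj_on u' I v - proj_on u I v) \<le> norm v + norm v"
    using norm_proj_on_le(1)[OF u fin, of v] norm_proj_on_le(1)[OF u' fin, of v]
      norm_triangle_ineq4[of "proj_on u' I v" "proj_on u I v"] by linarith
  also have "\<dots> \<le> 2 * s * norm v"
    using False mult_right_mono[of 1 s "norm v"] by simp
  finally show ?thesis .
next
  case True
  let ?P = "proj_on u I" and ?P' = "proj_on u' I"
  have s2: "0 < 1 - s\<^sup>2"
    using True \<open>0 \<le> s\<close> by (simp add: power_less_one_iff abs_square_less_1)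
  \<comment> \<open>By Pythagoras, \<open>P\<close> is bounded below on the range of
    \<open>P'\<close>, hence injective there.\<close>
  have low: "(1 - s\<^sup>2) * (norm (?P' v))\<^sup>2 \<le> (norm (?P (?P' v)))\<^sup>2" for v
  proof -
    have "(norm (?P' v - ?P (?P' v)))\<^sup>2 \<le> (s * norm (?P' v))\<^sup>2"
      using s[of "?P' v"] unfolding proj_on_idem[OF u' fin] by (rule power_mono) simp
    then show ?thesis
      using norm_sub_proj_on[OF u fin, of "?P' v"] by (simp add: power_mult_distrib algebra_simps)
  qed
  have inj: "w = 0" if w: "w \<in> span (u' ` I)" "?P w = 0" for w
  proof -
    obtain v where "w = ?P' v" using w(1) range_proj_on[OF u' fin] by auto
    then have "(1 - s\<^sup>2) * (norm w)\<^sup>2 \<le> 0" using low[of v] w(2) by simp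
    then show ?thesis using s2 by (simp add: mult_le_0_iff)
  qed
  \<comment> \<open>Equality of the dimensions enters here, through \<open>card I\<close>.\<close>
  have surj: "?P ` span (u' ` I) = span (u ` I)"
  proof (rule subspace_dim_equal)
    show "subspace (?P ` span (u' ` I))"
      by (intro linear_subspace_image linear_proj_on subspace_span)
    show "?P ` span (u' ` I) \<subseteq> span (u ` I)"
      using proj_on_in_span by blast
    have "dim (?P ` span (u' ` I)) = dim (span (u' ` I))"
      by (rule dim_image_injective) (use inj linear_proj_on in auto)
    then show "dim (span (u ` I)) \<le> dim (?P ` span (u' ` I))"
      using orthonormal_on_independent(3)[OF u fin] orthonormal_on_independent(3)[OF u' fin] by simp
  qed simp
  define z where "z = v - ?P' v"
  define w where "w = ?P z"
  have "w \<in> ?P ` span (u' ` I)"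
    unfolding surj w_def by (rule proj_on_in_span)
  then obtain v0 where v0: "w = ?P (?P' v0)"
    unfolding range_proj_on[OF u' fin, symmetric] by auto
  \<comment> \<open>The lower bound passes to \<open>P'\<close> on the range of \<open>P\<close>:
    surjectivity gives \<open>w = P (P' v0)\<close>, Cauchy-Schwarz bounds
    \<open>(norm w)\<^sup>2\<close> by \<open>norm (P' w) * norm (P' v0)\<close>, and
    \<open>low\<close> controls \<open>norm (P' v0)\<close> by \<open>norm w\<close>.\<close>
  have w_low: "(1 - s\<^sup>2) * (norm w)\<^sup>2 \<le> (norm (?P' w))\<^sup>2"
  proof (cases "w = 0")
    case False
    have "(norm w)\<^sup>2 = w \<bullet> ?P' v0"
      using norm_proj_on[OF u fin, of "?P' v0"] unfolding v0 .
    also have "\<dots> = ?P' w \<bullet> ?P' v0"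
      by (metis inner_proj_on_commute proj_on_idem[OF u' fin])
    also have "\<dots> \<le> norm (?P' w) * norm (?P' v0)"
      by (rule norm_cauchy_schwarz)
    finally have "((norm w)\<^sup>2)\<^sup>2 \<le> (norm (?P' w) * norm (?P' v0))\<^sup>2"
      by (rule power_mono) simp
    then have "(1 - s\<^sup>2) * ((norm w)\<^sup>2)\<^sup>2 \<le> (norm (?P' w))\<^sup>2 * ((1 - s\<^sup>2) * (norm (?P' v0))\<^sup>2)"
      using mult_left_mono[of _ _ "1 - s\<^sup>2"] s2 by (simp add: power_mult_distrib mult_ac)
    also have "\<dots> \<le> (norm (?P' w))\<^sup>2 * (norm w)\<^sup>2"
      using low[of v0] v0 by (intro mult_left_mono) auto
    finally have "((1 - s\<^sup>2) * (norm w)\<^sup>2) * (norm w)\<^sup>2 \<le> (norm (?P' w))\<^sup>2 * (norm w)\<^sup>2"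
      by (simp add: power2_eq_square mult.assoc)
    then show ?thesis using False by simp
  qed simp
  have "(norm (w - ?P' w))\<^sup>2 \<le> (s * norm w)\<^sup>2"
    using w_low norm_sub_proj_on[OF u' fin, of w] by (simp add: power_mult_distrib algebra_simps)
  then have wd: "norm (w - ?P' w) \<le> s * norm w"
    by (rule power2_le_imp_le) (use \<open>0 \<le> s\<close> in simp)
  have "norm w \<le> s * norm z"
  proof (cases "w = 0")
    case False
    \<comment> \<open>Since \<open>z\<close> is orthogonal to the range of \<open>P'\<close>, only
      the small vector \<open>w - P' w\<close> contributes to the inner product with
      \<open>z\<close>.\<close>
    have "norm w * norm w = w \<bullet> z"
      using norm_proj_on[OF u fin, of z] unfolding w_def by (simp add: power2_eq_square)
    also have "\<dots> = (w - ?P' w) \<bullet> z"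
      unfolding z_def
      by (simp add: inner_diff_left inner_diff_right inner_proj_on_commute proj_on_idem[OF u' fin])
    also have "\<dots> \<le> norm (w - ?P' w) * norm z"
      by (rule norm_cauchy_schwarz)
    also have "\<dots> \<le> (s * norm w) * norm z"
      using wd by (rule mult_right_mono) simp
    finally have "norm w * norm w \<le> norm w * (s * norm z)" by (simp add: mult_ac)
    then show ?thesis using False by simp
  qed (use \<open>0 \<le> s\<close> in simp)
  also have "\<dots> \<le> s * norm v"
    using norm_proj_on_le(2)[OF u' fin, of v] \<open>0 \<le> s\<close> unfolding z_def by (rule mult_left_mono)
  finally have "norm w \<le> s * norm v" .
  moreover have eq: "?P' v - ?P v = (?P' v - ?P (?P' v)) - w"
    unfolding w_def z_def linear_diff[OF linear_proj_on] by simp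
  ultimately show ?thesis
    using s[of v] norm_triangle_ineq4[of "?P' v - ?P (?P' v)" w] unfolding eq by linarith
qed

section \<open>Weyl's inequality by Rayleigh quotients\<close>

lemma inner_eigen_sum:
  assumes "linear A" "orthonormal_on I u" "finite I" "\<And>i. i \<in> I \<Longrightarrow> A (u i) = lam i *\<^sub>R u i"
    and v: "proj_on u I v = v"
  shows "v \<bullet> A v = (\<Sum>i\<in>I. lam i * (u i \<bullet> v)\<^sup>2)"
proof -
  have "A v = (\<Sum>i\<in>I. (u i \<bullet> v) *\<^sub>R A (u i))"
    using linear_sum[OF assms(1)] linear_cmul[OF assms(1)] v unfolding proj_on_def
    by (metis (no_types, lifting) sum.cong)
  then show ?thesis
    using assms(4) by (simp add: inner_sum_right inner_commute power2_eq_square algebra_simps)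
qed

lemma norm_eq_sum_coeffs:
  assumes "orthonormal_on I u" "finite I" "proj_on u I v = v"
  shows "(norm v)\<^sup>2 = (\<Sum>i\<in>I. (u i \<bullet> v)\<^sup>2)"
  using norm_orthonormal_sum[OF assms(1,2)] assms(3) unfolding proj_on_def by metis

text \<open>Some nonzero \<open>v\<close> in the span of the first \<open>p\<close> vectors
  \<open>u i\<close> is orthogonal to the first \<open>p - 1\<close> vectors \<open>u' i\<close>.
  Its Rayleigh quotient is at least \<open>lam p\<close> for \<open>A\<close> and at most
  \<open>lam' p\<close> for \<open>A'\<close>, and the two differ by at most
  \<open>e\<close>.\<close>

lemma weyl_lower_bound:
  fixes A A' :: "'a::euclidean_space \<Rightarrow> 'a"
  assumes lin: "linear A" "linear A'"
    and u: "orthonormal_on {1..DIM('a)} u" "\<And>i. i \<in> {1..DIM('a)} \<Longrightarrow> A (u i) = lam i *\<^sub>R u i"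
    and u': "orthonormal_on {1..DIM('a)} u'" "\<And>i. i \<in> {1..DIM('a)} \<Longrightarrow> A' (u' i) = lam' i *\<^sub>R u' i"
    and p: "1 \<le> p" "p \<le> DIM('a)"
    and lam: "\<And>i. 1 \<le> i \<Longrightarrow> i \<le> p \<Longrightarrow> lam p \<le> lam i"
    and lam': "\<And>i. p \<le> i \<Longrightarrow> i \<le> DIM('a) \<Longrightarrow> lam' i \<le> lam' p"
    and e: "\<And>v. norm (A' v - A v) \<le> e * norm v"
  shows "lam p - e \<le> lam' p"
proof -
  let ?I = "{1..p}" and ?J = "{1..p - 1}" and ?L = "{p..DIM('a)}"
  have oI: "orthonormal_on ?I u" and oJ: "orthonormal_on ?J u'" and oL: "orthonormal_on ?L u'"
    using p by (auto intro!: orthonormal_on_subset[OF u(1)] orthonormal_on_subset[OF u'(1)])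
  \<comment> \<open>Otherwise a \<open>p\<close>-dimensional space would embed into one of dimension
    \<open>p - 1\<close>.\<close>
  obtain v where v: "v \<in> span (u ` ?I)" "v \<noteq> 0" "proj_on u' ?J v = 0"
  proof (rule ccontr)
    assume "\<not> thesis"
    then have "dim (proj_on u' ?J ` span (u ` ?I)) = dim (span (u ` ?I))"
      using that by (intro dim_image_injective linear_proj_on) auto
    moreover have "dim (proj_on u' ?J ` span (u ` ?I)) \<le> dim (span (u' ` ?J))"
      using proj_on_in_span by (intro dim_subset) blast
    ultimately show False
      using orthonormal_on_independent(3)[OF oI] orthonormal_on_independent(3)[OF oJ] p by simp
  qed
  have vI: "proj_on u ?I v = v"
    using v(1) proj_on_idem[OF oI] unfolding range_proj_on[OF oI finite_atLeastAtMost, symmetric] by auto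
  have "?J \<union> ?L = {1..DIM('a)}" "?J \<inter> ?L = {}"
    using p by auto
  then have "v = proj_on u' ?J v + proj_on u' ?L v"
    using u'(1) by (intro proj_on_decomp) auto
  then have vL: "proj_on u' ?L v = v"
    using v(3) by simp
  have "lam p * (norm v)\<^sup>2 = (\<Sum>i\<in>?I. lam p * (u i \<bullet> v)\<^sup>2)"
    using norm_eq_sum_coeffs[OF oI _ vI] by (simp add: sum_distrib_left)
  also have "\<dots> \<le> (\<Sum>i\<in>?I. lam i * (u i \<bullet> v)\<^sup>2)"
    using lam by (intro sum_mono mult_right_mono) auto
  also have "\<dots> = v \<bullet> A v"
    using p u(2) by (intro inner_eigen_sum[OF lin(1) oI _ _ vI, symmetric]) auto
  also have "\<dots> = v \<bullet> A' v - v \<bullet> (A' v - A v)"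
    by (simp add: inner_diff_right)
  also have "\<dots> \<le> v \<bullet> A' v + e * (norm v)\<^sup>2"
  proof -
    have "- (v \<bullet> (A' v - A v)) \<le> norm v * norm (A' v - A v)"
      using Cauchy_Schwarz_ineq2[of v "A' v - A v"] by linarith
    also have "\<dots> \<le> norm v * (e * norm v)"
      using e by (intro mult_left_mono) auto
    finally show ?thesis by (simp add: power2_eq_square mult_ac)
  qed
  also have "v \<bullet> A' v = (\<Sum>i\<in>?L. lam' i * (u' i \<bullet> v)\<^sup>2)"
    using p u'(2) by (intro inner_eigen_sum[OF lin(2) oL _ _ vL]) auto
  also have "\<dots> \<le> (\<Sum>i\<in>?L. lam' p * (u' i \<bullet> v)\<^sup>2)"
    using lam' by (intro sum_mono mult_right_mono) auto
  also have "\<dots> = lam' p * (norm v)\<^sup>2"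
    using norm_eq_sum_coeffs[OF oL _ vL] by (simp add: sum_distrib_left)
  finally have "(lam p - e) * (norm v)\<^sup>2 \<le> lam' p * (norm v)\<^sup>2"
    by (simp add: algebra_simps)
  then show ?thesis using v(2) by simp
qed

section \<open>Entrywise bounds and the passage from matrices to maps\<close>

text \<open>Source of the term \<open>r\<^sup>2 * x\<close>: the triangle inequality is applied once
  over the input coordinates in \<open>S\<close> and once over the output coordinates in
  \<open>M\<close>, each time with at most \<open>card S\<close> terms.\<close>

lemma proj_on_entries_bound:
  assumes o: "orthonormal_on S u" "finite S" and M: "M \<subseteq> S" and B: "linear B"
    and x: "\<And>i j. i \<in> S \<Longrightarrow> j \<in> S \<Longrightarrow> \<bar>u i \<bullet> B (u j)\<bar> \<le> x"
    and "0 \<le> x"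
  shows "norm (proj_on u M (B (proj_on u S w))) \<le> (real (card S))\<^sup>2 * x * norm w"
proof -
  let ?z = "B (proj_on u S w)"
  have unit: "norm (u i) = 1" if "i \<in> S" for i
    using o that unfolding orthonormal_on_def norm_eq_sqrt_inner by simp
  have entry: "\<bar>u i \<bullet> ?z\<bar> \<le> real (card S) * (x * norm w)" if i: "i \<in> S" for i
  proof -
    have "u i \<bullet> ?z = (\<Sum>j\<in>S. (u j \<bullet> w) * (u i \<bullet> B (u j)))"
      unfolding proj_on_def linear_sum[OF B] linear_cmul[OF B] inner_sum_right by simp
    also have "\<bar>\<dots>\<bar> \<le> (\<Sum>j\<in>S. \<bar>(u j \<bullet> w) * (u i \<bullet> B (u j))\<bar>)"
      by (rule sum_abs)
    also have "\<dots> \<le> (\<Sum>j\<in>S. norm w * x)"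
    proof (rule sum_mono)
      fix j assume j: "j \<in> S"
      have "\<bar>u j \<bullet> w\<bar> \<le> norm w"
        using Cauchy_Schwarz_ineq2[of "u j" w] unit[OF j] by simp
      then show "\<bar>(u j \<bullet> w) * (u i \<bullet> B (u j))\<bar> \<le> norm w * x"
        unfolding abs_mult using x[OF i j] by (intro mult_mono) auto
    qed
    finally show ?thesis by (simp add: mult_ac)
  qed
  have "norm (proj_on u M ?z) \<le> (\<Sum>i\<in>M. norm ((u i \<bullet> ?z) *\<^sub>R u i))"
    unfolding proj_on_def by (rule norm_sum)
  also have "\<dots> \<le> (\<Sum>i\<in>M. real (card S) * (x * norm w))"
    using entry unit M by (intro sum_mono) auto
  also have "\<dots> = real (card M) * (real (card S) * (x * norm w))"
    by simp
  also have "\<dots> \<le> real (card S) * (real (card S) * (x * norm w))"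
    using card_mono[OF o(2) M] \<open>0 \<le> x\<close> by (intro mult_right_mono) auto
  finally show ?thesis by (simp add: power2_eq_square mult_ac)
qed

lemma symmetric_matrix_inner:
  fixes M :: "real^'n^'n"
  assumes "transpose M = M"
  shows "(M *v v) \<bullet> w = v \<bullet> (M *v w)"
  using dot_lmul_matrix[of v M w] assms by (metis transpose_matrix_vector)

lemma eigenprojection_mult_vec: "eigenprojection u p *v v = proj_on u {1..p} v"
proof -
  have "outer (u i) (u i) *v v = (u i \<bullet> v) *\<^sub>R u i" for i
    by (simp add: vec_eq_iff outer_def matrix_vector_mult_def inner_vec_def sum_distrib_left mult_ac)
  moreover have "(\<Sum>i\<in>I. f i) *v v = (\<Sum>i\<in>I. f i *v v)"
    if "finite I" for I :: "nat set" and f :: "nat \<Rightarrow> real^'a^'a"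
    using that by (induction I) (auto simp: matrix_vector_mult_add_rdistrib)
  ultimately show ?thesis unfolding eigenprojection_def proj_on_def by simp
qed

lemma norm_matrix_vector_le_spectral_norm: "norm (M *v v) \<le> spectral_norm M * norm v"
  unfolding spectral_norm_def by (rule onorm) (simp add: matrix_vector_mul_bounded_linear)

section \<open>Far block, near block and the final constants\<close>

theorem theorem2p1:
  fixes A E A' :: "real^'n^'n"
    and lam lam' :: "nat \<Rightarrow> real"
    and u u' :: "nat \<Rightarrow> real^'n"
    and p r :: nat
    and \<sigma>\<^sub>1 \<delta> x :: real
  assumes "transpose A = A" and "transpose E = E" and "A' = A + E"
    and "ordered_eigensystem A lam u"
    and "ordered_eigensystem A' lam' u'"
    and "\<sigma>\<^sub>1 = Max ((\<lambda>i. \<bar>lam i\<bar>) ` {1..CARD('n)})"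
    and "1 \<le> p" and "p < CARD('n)"
    and "\<delta> = lam p - lam (p + 1)" and "\<delta> > 0"
    and "p \<le> r" and "r + 1 \<le> CARD('n)"
    and "\<bar>lam p\<bar> / 2 \<le> \<bar>lam p - lam (r + 1)\<bar>"
    and "\<And>s. p \<le> s \<Longrightarrow> s < r \<Longrightarrow> \<not> \<bar>lam p\<bar> / 2 \<le> \<bar>lam p - lam (s + 1)\<bar>"
    and "x = Max ((\<lambda>(i, j). \<bar>u i \<bullet> (E *v u j)\<bar>) ` ({1..r} \<times> {1..r}))"
    and "4 * spectral_norm E \<le> \<delta>" and "\<delta> \<le> \<bar>lam p\<bar> / 4"
  shows "spectral_norm (eigenprojection u' p - eigenprojection u p)
    \<le> 24 * (spectral_norm E / \<bar>lam p\<bar> * ln (6 * \<sigma>\<^sub>1 / \<delta>) + (real r)\<^sup>2 * x / \<delta>)"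
proof -
  define n where "n = CARD('n)"
  define e where "e = spectral_norm E"
  define l where "l = \<bar>lam p\<bar>"
  define D where "D = (\<lambda>v. E *v v)"
  let ?J = "{1..p}" and ?M = "{p+1..r}" and ?S = "{1..r}" and ?T = "{r+1..n}"
  let ?P = "proj_on u ?J" and ?P' = "proj_on u' ?J"
  have p: "1 \<le> p" "p < n" "p \<le> r" "r + 1 \<le> n"
    using assms unfolding n_def by auto
  have eig: "A *v u i = lam i *\<^sub>R u i" "A' *v u' i = lam' i *\<^sub>R u' i" if "i \<in> {1..n}" for i
    using assms(4,5) that unfolding ordered_eigensystem_def n_def by auto
  have mono: "lam j \<le> lam i" "lam' j \<le> lam' i" if "1 \<le> i" "i \<le> j" "j \<le> n" for i j
    using assms(4,5) that unfolding ordered_eigensystem_def n_def by auto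
  have oN: "orthonormal_on {1..n} u" and oN': "orthonormal_on {1..n} u'"
    using assms(4,5) unfolding ordered_eigensystem_def orthonormal_on_def n_def by auto
  have oJ: "orthonormal_on ?J u" and oM: "orthonormal_on ?M u" and oS: "orthonormal_on ?S u"
    and oT: "orthonormal_on ?T u" and oJ': "orthonormal_on ?J u'"
    using p by (auto intro: orthonormal_on_subset[OF oN] orthonormal_on_subset[OF oN'])
  have linD: "linear D" unfolding D_def by (rule matrix_vector_mul_linear)
  have A': "A' *v w - A *v w = D w" for w
    unfolding D_def assms(3) by (simp add: matrix_vector_mult_add_rdistrib)
  have D_le: "norm (D w) \<le> e * norm w" for w
    unfolding D_def e_def by (rule norm_matrix_vector_le_spectral_norm)
  have e0: "0 \<le> e"
    unfolding e_def spectral_norm_def by (rule onorm_pos_le) (simp add: matrix_vector_mul_bounded_linear)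
  have e\<delta>: "4 * e \<le> \<delta>" "\<delta> \<le> l / 4" "0 < \<delta>"
    using assms unfolding e_def l_def by auto
  have l0: "0 < l" using e\<delta> by linarith
  have x: "\<bar>u i \<bullet> D (u j)\<bar> \<le> x" if "i \<in> ?S" "j \<in> ?S" for i j
  proof -
    have "\<bar>u i \<bullet> (E *v u j)\<bar> \<in> (\<lambda>(i, j). \<bar>u i \<bullet> (E *v u j)\<bar>) ` (?S \<times> ?S)"
      using that by (intro image_eqI[of _ _ "(i, j)"]) auto
    then show ?thesis unfolding D_def assms(15) by (intro Max_ge) auto
  qed
  have x0: "0 \<le> x" using x[of 1 1] p by force
  have lamp': "lam p - e \<le> lam' j" if "j \<in> ?J" for j
  proof -
    have "lam p - e \<le> lam' p"
      by (rule weyl_lower_bound[of "(*v) A" "(*v) A'" u lam u' lam'])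
        (use p oN oN' eig mono D_le A' in \<open>auto simp flip: n_def\<close>)
    also have "\<dots> \<le> lam' j" using that p by (intro mono) auto
    finally show ?thesis .
  qed
  \<comment> \<open>Far-block bound: the gap is at least \<open>l / 2 - e\<close>, and
    \<open>e \<le> \<delta> / 4 \<le> l / 16\<close> makes this at least
    \<open>7 / 16 * l\<close>.\<close>
  define a where "a = 16 / 7 * e / l"
  \<comment> \<open>Near-block bound: the gap is at least
    \<open>\<delta> - e \<ge> 3 / 4 * \<delta>\<close>, and the bracket bounds the part of
    \<open>E\<close> seen by this block.\<close>
  define b where "b = 4 / (3 * \<delta>) * ((real r)\<^sup>2 * x + e * a)"
  have a0: "0 \<le> a" unfolding a_def using e0 l0 by simp
  have far: "norm (proj_on u ?T (?P' v)) \<le> a * norm v" for v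
  proof -
    have top: "lam i \<le> lam p - l / 2" if "i \<in> ?T" for i
    proof -
      have "lam i \<le> lam (r + 1)" "lam (r + 1) \<le> lam p" using that p by (auto intro: mono)
      \<comment> \<open>As \<open>lam (r + 1) \<le> lam p\<close>, the absolute value in the choice
        of \<open>r\<close> opens with a definite sign.\<close>
      then show ?thesis using assms(13) unfolding l_def by linarith
    qed
    have "norm (proj_on u ?T (?P' v)) \<le> e / ((lam p - e) - (lam p - l / 2)) * norm v"
    proof (rule sin_theta[of "(*v) A'" "(*v) A" ?T u lam ?J u' lam'])
      show "norm (proj_on u ?T (A' *v ?P' w - A *v ?P' w)) \<le> e * norm w" for w
      proof -
        have "norm (proj_on u ?T (D (?P' w))) \<le> e * norm (?P' w)"
          using norm_proj_on_le(1)[OF oT] D_le order_trans by (metis finite_atLeastAtMost)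
        also have "\<dots> \<le> e * norm w"
          using norm_proj_on_le(1)[OF oJ'] e0 by (intro mult_left_mono) auto
        finally show ?thesis unfolding A' .
      qed
    qed (use p oT oJ' eig top lamp' e\<delta> l0 symmetric_matrix_inner[OF assms(1)] in auto)
    also have "\<dots> \<le> a * norm v"
    proof (rule mult_right_mono)
      have "e / ((lam p - e) - (lam p - l / 2)) \<le> e / (7 / 16 * l)"
        using e\<delta> e0 l0 by (intro divide_left_mono) auto
      then show "e / ((lam p - e) - (lam p - l / 2)) \<le> a"
        unfolding a_def by simp
    qed simp
    finally show ?thesis .
  qed
  have near: "norm (proj_on u ?M (?P' v)) \<le> b * norm v" for v
  proof -
    \<comment> \<open>Splitting \<open>?P' w\<close> at \<open>r\<close>: the part in
      \<open>?S\<close> meets only entries of \<open>E\<close> bounded by \<open>x\<close>, while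
      the part in \<open>?T\<close> is small by \<open>far\<close>, so the full norm of
      \<open>E\<close> is affordable there.\<close>
    have Y: "norm (proj_on u ?M (A' *v ?P' w - A *v ?P' w)) \<le> ((real r)\<^sup>2 * x + e * a) * norm w" for w
    proof -
      have "?S \<union> ?T = {1..n}" "?S \<inter> ?T = {}" using p by auto
      then have "?P' w = proj_on u ?S (?P' w) + proj_on u ?T (?P' w)"
        using oN by (intro proj_on_decomp) (auto simp: n_def)
      then have "proj_on u ?M (D (?P' w))
          = proj_on u ?M (D (proj_on u ?S (?P' w))) + proj_on u ?M (D (proj_on u ?T (?P' w)))"
        using linear_add[OF linD] linear_add[OF linear_proj_on] by metis
      then have "norm (proj_on u ?M (D (?P' w)))
          \<le> norm (proj_on u ?M (D (proj_on u ?S (?P' w)))) + norm (proj_on u ?M (D (proj_on u ?T (?P' w))))"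
        using norm_triangle_ineq by metis
      also have "norm (proj_on u ?M (D (proj_on u ?S (?P' w)))) \<le> (real (card ?S))\<^sup>2 * x * norm (?P' w)"
        using p by (intro proj_on_entries_bound oS linD x x0) auto
      also have "\<dots> \<le> (real r)\<^sup>2 * x * norm w"
        using norm_proj_on_le(1)[OF oJ'] x0 by (simp add: mult_left_mono)
      also have "norm (proj_on u ?M (D (proj_on u ?T (?P' w)))) \<le> norm (D (proj_on u ?T (?P' w)))"
        using norm_proj_on_le(1)[OF oM] by simp
      also have "\<dots> \<le> e * norm (proj_on u ?T (?P' w))" by (rule D_le)
      also have "\<dots> \<le> e * (a * norm w)" using far e0 by (intro mult_left_mono)
      finally show ?thesis unfolding A' by (simp add: algebra_simps)
    qed
    have top: "lam i \<le> lam p - \<delta>" if "i \<in> ?M" for i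
      using that p mono[of "p + 1" i] assms(9) by auto
    have "norm (proj_on u ?M (?P' v))
        \<le> ((real r)\<^sup>2 * x + e * a) / ((lam p - e) - (lam p - \<delta>)) * norm v"
      by (rule sin_theta[of "(*v) A'" "(*v) A" ?M u lam ?J u' lam', OF _ _ _ _ _ _ _ _ _ _ _ Y])
        (use p oM oJ' eig top lamp' e\<delta> l0 symmetric_matrix_inner[OF assms(1)] in auto)
    also have "\<dots> \<le> b * norm v"
    proof (rule mult_right_mono)
      have "((real r)\<^sup>2 * x + e * a) / ((lam p - e) - (lam p - \<delta>)) \<le> ((real r)\<^sup>2 * x + e * a) / (3 / 4 * \<delta>)"
        using e\<delta> e0 x0 a0 by (intro divide_left_mono) auto
      then show "((real r)\<^sup>2 * x + e * a) / ((lam p - e) - (lam p - \<delta>)) \<le> b"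
        unfolding b_def by (simp add: field_simps)
    qed simp
    finally show ?thesis .
  qed
  have split: "?P' v - ?P (?P' v) = proj_on u ?M (?P' v) + proj_on u ?T (?P' v)" for v
  proof -
    have "?J \<union> (?M \<union> ?T) = {1..n}" "?J \<inter> (?M \<union> ?T) = {}" "?M \<inter> ?T = {}" using p by auto
    then have "?P' v = ?P (?P' v) + proj_on u (?M \<union> ?T) (?P' v)"
      using oN by (intro proj_on_decomp) (auto simp: n_def)
    also have "proj_on u (?M \<union> ?T) (?P' v) = proj_on u ?M (?P' v) + proj_on u ?T (?P' v)"
      using \<open>?M \<inter> ?T = {}\<close> by (intro proj_on_Un) auto
    finally show ?thesis by (simp add: algebra_simps)
  qed
  have b0: "0 \<le> b" unfolding b_def using e\<delta> e0 a0 x0 by simp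
  have "norm (?P' v - ?P v) \<le> 2 * (b + a) * norm v" for v
  proof (rule norm_diff_proj_on_le[OF oJ oJ'])
    show "norm (?P' v - ?P (?P' v)) \<le> (b + a) * norm v" for v
      unfolding split using norm_triangle_le[OF add_mono[OF near far]] by (simp add: algebra_simps)
  qed (use a0 b0 in auto)
  then have "spectral_norm (eigenprojection u' p - eigenprojection u p) \<le> 2 * (b + a)"
    unfolding spectral_norm_def
    by (intro onorm_le) (simp add: matrix_vector_mult_diff_rdistrib eigenprojection_mult_vec)
  \<comment> \<open>Since \<open>e * a / \<delta> \<le> a / 4\<close>, one has
    \<open>b + a \<le> 4 / 3 * ((real r)\<^sup>2 * x / \<delta> + a)\<close>; doubling gives the
    coefficients \<open>8 / 3\<close> and \<open>128 / 21\<close>, both below 24.\<close>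
  also have "\<dots> \<le> 24 * (e / l + (real r)\<^sup>2 * x / \<delta>)"
  proof -
    have "e * a / \<delta> \<le> 1 / 4 * a"
      using e\<delta> a0 mult_right_mono[of "4 * e" \<delta> a] by (simp add: field_simps)
    moreover have "b = 4 / 3 * ((real r)\<^sup>2 * x / \<delta>) + 4 / 3 * (e * a / \<delta>)"
      unfolding b_def using e\<delta> by (simp add: field_simps)
    moreover have "a = 16 / 7 * (e / l)" unfolding a_def by simp
    moreover have "0 \<le> (real r)\<^sup>2 * x / \<delta>" "0 \<le> e / l" using x0 e\<delta> e0 l0 by auto
    ultimately show ?thesis by argo
  qed
  also have "\<dots> \<le> 24 * (e / l * ln (6 * \<sigma>\<^sub>1 / \<delta>) + (real r)\<^sup>2 * x / \<delta>)"
  proof -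
    \<comment> \<open>The logarithm is at least 1:
      \<open>4 * \<delta> \<le> l \<le> \<sigma>\<^sub>1\<close> puts its argument above 3, hence
      above \<open>exp 1\<close>.\<close>
    have "l \<le> \<sigma>\<^sub>1" unfolding l_def assms(6) using p n_def by (intro Max_ge) auto
    then have "3 \<le> 6 * \<sigma>\<^sub>1 / \<delta>"
      using e\<delta> by (simp add: field_simps)
    then have "exp 1 \<le> 6 * \<sigma>\<^sub>1 / \<delta>"
      using exp_le by linarith
    then have "1 \<le> ln (6 * \<sigma>\<^sub>1 / \<delta>)"
      by (metis exp_gt_zero ln_exp ln_mono order_less_le_trans)
    then have "e / l * 1 \<le> e / l * ln (6 * \<sigma>\<^sub>1 / \<delta>)"
      using e0 l0 by (intro mult_left_mono) auto
    then show ?thesis by simp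
  qed
  finally show ?thesis unfolding e_def l_def .
qed

end
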